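(* Let $\mathcal X\subset E$ be a nonempty convex compact subset of a Euclidean space $E$ given by an essentially strictly feasible $\mathcal K$-representation $$\mathcal X=\{x:\exists v: Ax+Bv\leq_{\mathbf L}b\},\qquad \mathbf L\in\mathcal K,$$ so that, by conic duality, for $\epsilon\ge 0$ the set $\mathcal X_*(\epsilon)=\{[t;g]\in\mathbb R\times E:\sup_{y\in\mathcal X}[t-\langle g,y\rangle]\leq\epsilon\}$ admits the $\mathcal K$-representation $$\mathcal X_*(\epsilon)=\{[t;g]:\exists\lambda: A^T\lambda+g=0,\ B^T\lambda=0,\ t+b^T\lambda\leq\epsilon,\ \lambda\geq_{\mathbf L^*}0\}.$$ Let $F:\mathcal X\to E$ be a continuous monotone vector field, and let the conic constraint $Xx+Gg+tT+Uu\leq_{\mathbf K}a$ ($\mathbf K\in\mathcal K$) in variables $t,g,x,u$ be an almost $\mathcal K$-representation of $(F,\mathcal X)$. Then for every $\epsilon>0$ the system of conic constraints $$Xx+Gg+tT+Uu\leq_{\mathbf K}a,\quad A^T\lambda+g=0,\quad B^T\lambda=0,\quad t+b^T\lambda\leq\epsilon,\quad \lambda\geq_{\mathbf L^*}0$$ in variables $x,g,t,u,\lambda$ is feasible, and the $x$-component of any feasible solution belongs to $\mathcal X$ and is an $\epsilon$-solution to the variational inequality $\mathrm{VI}(F,\mathcal X)$: $$\sup_{y\in\mathcal X}\langle F(y),x-y\rangle\leq\epsilon.$$ When $Xx+Gg+tT+Uu\leq_{\mathbf K}a$ is a $\mathcal K$-representation of $(F,\mathcal X)$, the same conclusion holds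 for all $\epsilon\geq0$.
   Context: $\mathcal K$ is a fixed family of regular cones (closed, convex, pointed, with nonempty interior) in Euclidean spaces which contains $\mathbb R_+$, is closed under finite direct products, and is closed under passing from a cone $\mathbf K$ to its dual $\mathbf K^*$. $a\leq_{\mathbf K}b$ means $b-a\in\mathbf K$. A $\mathcal K$-representation of a set $X$ is a constraint $Ax+Bu\leq_{\mathbf K}c$, $\mathbf K\in\mathcal K$, with $X=\{x:\exists u:Ax+Bu\leq_{\mathbf K}c\}$. (Finite systems of such constraints, linear equalities and nonstrict linear inequalities are again equivalent to a single constraint of this type.) A conic constraint $Ax\leq_{\mathbf K}a$ is essentially strictly feasible if $\mathbf K=\mathbb R^m_+\times\mathbf M$ with regular $\mathbf M$ (either factor may be absent), so that it reads $Px\leq p$, $Qx\leq_{\mathbf M}q$, and there is $\bar x$ with $P\bar x\leq p$ and $q-Q\bar x\in\operatorname{int}\mathbf M$; for a representation $Ax+Bu\leq_{\mathbf K}c$ this refers to the constraint in variables $(x,u)$. Let $\mathcal X$ be a nonempty convex subset of a Euclidean space $E$. A vector field $F:\mathcal X\to E$ is monotone if $\langle F(x)-F(y),x-y\rangle\geq0$ for all $x,y\in\mathcal X$. $\mathrm{VI}(F,\mathcal X)$: find $x_*\in\mathcal X$ with $\langle F(y),x_*-y\rangle\leq0$ for all $y\in\mathcal X$. For continuous monotone $F$ put $$\mathcal F[F,\mathcal X]=\{[t;g;x]\in\mathbb R\times E\times E: x\in\mathcal X,\ t-\langle g,y\rangle\geq\langle F(y),x-y\rangle\ \forall y\in\mathcal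 X\}.$$ A conic constraint $Xx+Gg+tT+Uu\leq_{\mathbf K}a$, $\mathbf K\in\mathcal K$, in variables $t\in\mathbb R$, $g\in E$, $x\in E$, $u\in\mathbb R^k$, with projection $\mathcal T=\{[t;g;x]:\exists u: Xx+Gg+tT+Uu\leq_{\mathbf K}a\}$, is a $\mathcal K$-representation of $(F,\mathcal X)$ if (i) $\mathcal T\subset\mathcal F[F,\mathcal X]$ and $\mathcal T$ is $t$-monotone: $[t;g;x]\in\mathcal T$, $t'\geq t$ imply $[t';g;x]\in\mathcal T$; and (ii) $\mathcal T\supset\{[\langle F(x),x\rangle;F(x);x]:x\in\mathcal X\}$. It is an almost $\mathcal K$-representation of $(F,\mathcal X)$ if (i) holds and (ii') $\mathcal T\supset\{[t;F(x);x]:x\in\mathcal X,\ t>\langle F(x),x\rangle\}$. *)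

theory Defs
  imports "HOL-Analysis.Analysis"
begin

text \<open>
  A family of cones ranges over Euclidean spaces of all dimensions, so it cannot be a set of sets
  over one type of class \<^class>\<open>euclidean_space\<close>.  A family is therefore a function
  \<open>\<K> :: nat \<Rightarrow> (nat \<Rightarrow> real) set set\<close>, where \<open>\<K> n\<close> consists of the members lying in
  \<open>topspace (Euclidean_space n)\<close>, that is \<open>R^n\<close> as the sequences vanishing from index \<open>n\<close> on.
  The cones in the constraints live in types of class \<^class>\<open>euclidean_space\<close> and are tied to the
  family by writing their points in coordinates with respect to the standard basis.
\<close>

definition regular_cone :: "nat \<Rightarrow> (nat \<Rightarrow> real) set \<Rightarrow> bool" where
  "regular_cone n C \<longleftrightarrow>
     closedin (Euclidean_space n) C \<and>
     (\<forall>x\<in>C. \<forall>y\<in>C. \<forall>r\<ge>0. \<forall>s\<ge>0. (\<lambda>i. r * x i + s * y i) \<in> C) \<and>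
     (\<forall>x. x \<in> C \<and> (\<lambda>i. - x i) \<in> C \<longrightarrow> x = (\<lambda>i. 0)) \<and>
     Euclidean_space n interior_of C \<noteq> {}"

definition orthant :: "nat \<Rightarrow> (nat \<Rightarrow> real) set" where
  "orthant m = {x \<in> topspace (Euclidean_space m). \<forall>i<m. 0 \<le> x i}"

text \<open>The direct product of \<open>C \<subseteq> R^m\<close> and \<open>D \<subseteq> R^n\<close>, as a subset of \<open>R^(m + n)\<close>.\<close>

definition direct_prod :: "nat \<Rightarrow> (nat \<Rightarrow> real) set \<Rightarrow> (nat \<Rightarrow> real) set \<Rightarrow> (nat \<Rightarrow> real) set" where
  "direct_prod m C D = {(\<lambda>i. if i < m then x i else y (i - m)) | x y. x \<in> C \<and> y \<in> D}"

definition coord_dual :: "nat \<Rightarrow> (nat \<Rightarrow> real) set \<Rightarrow> (nat \<Rightarrow> real) set" where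
  "coord_dual n C = {y \<in> topspace (Euclidean_space n). \<forall>x\<in>C. 0 \<le> (\<Sum>i<n. x i * y i)}"

definition cone_family :: "(nat \<Rightarrow> (nat \<Rightarrow> real) set set) \<Rightarrow> bool" where
  "cone_family \<K> \<longleftrightarrow>
     (\<forall>n. \<forall>C \<in> \<K> n. regular_cone n C) \<and>
     orthant 1 \<in> \<K> 1 \<and>
     (\<forall>m n. \<forall>C \<in> \<K> m. \<forall>D \<in> \<K> n. direct_prod m C D \<in> \<K> (m + n)) \<and>
     (\<forall>n. \<forall>C \<in> \<K> n. coord_dual n C \<in> \<K> n)"

text \<open>An enumeration \<open>e\<close> of the standard basis identifies a Euclidean space with \<open>R^n\<close>.\<close>

definition basis_enum :: "(nat \<Rightarrow> 'k::euclidean_space) \<Rightarrow> bool" where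
  "basis_enum e \<longleftrightarrow> bij_betw e {..<DIM('k)} Basis"

definition coords :: "(nat \<Rightarrow> 'k::euclidean_space) \<Rightarrow> 'k \<Rightarrow> nat \<Rightarrow> real" where
  "coords e z = (\<lambda>i. if i < DIM('k) then z \<bullet> e i else 0)"

definition in_family :: "(nat \<Rightarrow> (nat \<Rightarrow> real) set set) \<Rightarrow> 'k::euclidean_space set \<Rightarrow> bool" where
  "in_family \<K> K \<longleftrightarrow> (\<exists>e. basis_enum e \<and> coords e ` K \<in> \<K> DIM('k))"

definition dual_cone :: "'k::euclidean_space set \<Rightarrow> 'k set" where
  "dual_cone K = {y. \<forall>x\<in>K. 0 \<le> x \<bullet> y}"

definition cone_le :: "'k::euclidean_space \<Rightarrow> 'k set \<Rightarrow> 'k \<Rightarrow> bool"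
    ("(_/ \<preceq>\<^bsub>_\<^esub> _)" [51, 0, 51] 50) where
  "a \<preceq>\<^bsub>K\<^esub> b \<longleftrightarrow> b - a \<in> K"

text \<open>
  For the constraint \<open>A z \<preceq>\<^bsub>K\<^esub> a\<close>: in suitable coordinates \<open>K\<close> is the product of the orthant of
  \<open>R^m\<close> and a regular cone \<open>M\<close> in \<open>R^q\<close>, and some \<open>z\<close> satisfies the first \<open>m\<close> scalar
  inequalities, and the \<open>M\<close>-part strictly.  An absent factor is \<open>m = 0\<close> or \<open>q = 0\<close>.
\<close>

definition ess_strictly_feasible ::
    "'k::euclidean_space set \<Rightarrow> ('z \<Rightarrow> 'k) \<Rightarrow> 'k \<Rightarrow> bool" where
  "ess_strictly_feasible K A a \<longleftrightarrow>
     (\<exists>e m q M. basis_enum e \<and> m + q = DIM('k) \<and> regular_cone q M \<and>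
        coords e ` K = direct_prod m (orthant m) M \<and>
        (\<exists>z. coords e (a - A z) \<in>
               direct_prod m (orthant m) (Euclidean_space q interior_of M)))"

definition set_representation ::
    "(nat \<Rightarrow> (nat \<Rightarrow> real) set set) \<Rightarrow> 'e::euclidean_space set \<Rightarrow>
     ('e \<Rightarrow> 'l::euclidean_space) \<Rightarrow> ('v::euclidean_space \<Rightarrow> 'l) \<Rightarrow> 'l set \<Rightarrow> 'l \<Rightarrow> bool" where
  "set_representation \<K> \<X> A B L b \<longleftrightarrow>
     linear A \<and> linear B \<and> in_family \<K> L \<and> \<X> = {x. \<exists>v. A x + B v \<preceq>\<^bsub>L\<^esub> b}"

definition monotone_field :: "('e::euclidean_space \<Rightarrow> 'e) \<Rightarrow> 'e set \<Rightarrow> bool" where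
  "monotone_field F \<X> \<longleftrightarrow> (\<forall>x\<in>\<X>. \<forall>y\<in>\<X>. 0 \<le> (F x - F y) \<bullet> (x - y))"

definition field_set :: "('e::euclidean_space \<Rightarrow> 'e) \<Rightarrow> 'e set \<Rightarrow> (real \<times> 'e \<times> 'e) set" where
  "field_set F \<X> =
     {(t, g, x). x \<in> \<X> \<and> (\<forall>y\<in>\<X>. t - g \<bullet> y \<ge> F y \<bullet> (x - y))}"

definition constraint_proj ::
    "('e::euclidean_space \<Rightarrow> 'k::euclidean_space) \<Rightarrow> ('e \<Rightarrow> 'k) \<Rightarrow> 'k \<Rightarrow>
     ('u::euclidean_space \<Rightarrow> 'k) \<Rightarrow> 'k set \<Rightarrow> 'k \<Rightarrow> (real \<times> 'e \<times> 'e) set" where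
  "constraint_proj X G T U K a =
     {(t, g, x). \<exists>u. X x + G g + t *\<^sub>R T + U u \<preceq>\<^bsub>K\<^esub> a}"

definition t_monotone :: "(real \<times> 'e \<times> 'e) set \<Rightarrow> bool" where
  "t_monotone S \<longleftrightarrow> (\<forall>t g x t'. (t, g, x) \<in> S \<and> t \<le> t' \<longrightarrow> (t', g, x) \<in> S)"

definition field_representation ::
    "(nat \<Rightarrow> (nat \<Rightarrow> real) set set) \<Rightarrow> ('e::euclidean_space \<Rightarrow> 'e) \<Rightarrow> 'e set \<Rightarrow>
     ('e \<Rightarrow> 'k::euclidean_space) \<Rightarrow> ('e \<Rightarrow> 'k) \<Rightarrow> 'k \<Rightarrow> ('u::euclidean_space \<Rightarrow> 'k) \<Rightarrow>
     'k set \<Rightarrow> 'k \<Rightarrow> bool" where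
  "field_representation \<K> F \<X> X G T U K a \<longleftrightarrow>
     linear X \<and> linear G \<and> linear U \<and> in_family \<K> K \<and>
     constraint_proj X G T U K a \<subseteq> field_set F \<X> \<and>
     t_monotone (constraint_proj X G T U K a) \<and>
     {(F x \<bullet> x, F x, x) | x. x \<in> \<X>} \<subseteq> constraint_proj X G T U K a"

definition almost_field_representation ::
    "(nat \<Rightarrow> (nat \<Rightarrow> real) set set) \<Rightarrow> ('e::euclidean_space \<Rightarrow> 'e) \<Rightarrow> 'e set \<Rightarrow>
     ('e \<Rightarrow> 'k::euclidean_space) \<Rightarrow> ('e \<Rightarrow> 'k) \<Rightarrow> 'k \<Rightarrow> ('u::euclidean_space \<Rightarrow> 'k) \<Rightarrow>
     'k set \<Rightarrow> 'k \<Rightarrow> bool" where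
  "almost_field_representation \<K> F \<X> X G T U K a \<longleftrightarrow>
     linear X \<and> linear G \<and> linear U \<and> in_family \<K> K \<and>
     constraint_proj X G T U K a \<subseteq> field_set F \<X> \<and>
     t_monotone (constraint_proj X G T U K a) \<and>
     {(t, F x, x) | t x. x \<in> \<X> \<and> F x \<bullet> x < t} \<subseteq> constraint_proj X G T U K a"

text \<open>
  The supremum is a real one; it is the true supremum whenever \<open>\<X>\<close> is nonempty and bounded.
\<close>

definition dual_set :: "'e::euclidean_space set \<Rightarrow> real \<Rightarrow> (real \<times> 'e) set" where
  "dual_set \<X> \<epsilon> = {(t, g). (SUP y\<in>\<X>. t - g \<bullet> y) \<le> \<epsilon>}"

definition dual_system ::
    "('e::euclidean_space \<Rightarrow> 'l::euclidean_space) \<Rightarrow> ('v::euclidean_space \<Rightarrow> 'l) \<Rightarrow>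
     'l set \<Rightarrow> 'l \<Rightarrow> real \<Rightarrow> real \<Rightarrow> 'e \<Rightarrow> 'l \<Rightarrow> bool" where
  "dual_system A B L b \<epsilon> t g \<mu> \<longleftrightarrow>
     adjoint A \<mu> + g = 0 \<and> adjoint B \<mu> = 0 \<and> t + b \<bullet> \<mu> \<le> \<epsilon> \<and> 0 \<preceq>\<^bsub>dual_cone L\<^esub> \<mu>"

end

(*
  Weak solutions are bounded by the dual system: membership in the set F[F, X] gives
  <F(y), x - y> <= t - <g, y>, and the dual multipliers bound the right-hand side by epsilon.
  Feasibility comes from a strong solution x, with F(x) . (x - y) <= 0 on X, which is a fixed point
  of the projection of x - F(x) onto X (Brouwer): take g = F(x) and t = F(x) . x + epsilon.
  The dual description of the set X_*(epsilon) is strong conic duality under essential strict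
  feasibility.
*)

theory Submission
  imports Defs
begin

section \<open>Strong duality for conic programs\<close>

text \<open>A finitely generated cone is closed, so a pair (c, \<gamma>) that no multiplier
  certifies can be strictly separated from the cone of certified pairs. The separating functional
  then produces a feasible point, or a feasible ray, on which the objective exceeds \<gamma>.
  Closedness takes the place of Slater's condition.\<close>

lemma polyhedral_cone_duality:
  fixes A :: "'z::euclidean_space \<Rightarrow> 'l::euclidean_space"
  assumes N: "finite N" and A: "linear A"
    and P: "P = {x. \<forall>n\<in>N. 0 \<le> x \<bullet> n}"
    and feasible: "a - A z0 \<in> P"
    and bound: "\<And>z. a - A z \<in> P \<Longrightarrow> c \<bullet> z \<le> \<gamma>"
  shows "\<exists>\<mu>\<in>dual_cone P. (\<forall>z. A z \<bullet> \<mu> = c \<bullet> z) \<and> a \<bullet> \<mu> \<le> \<gamma>"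
proof -
  \<comment> \<open>\<open>C\<close> consists of the pairs (adjoint A n, r) with n in the cone
    generated by \<open>N\<close> and r at least a . n. The generator (0, 1) supplies the slack s =
    r - a . n.\<close>
  define f where "f = (\<lambda>(n, s::real). (adjoint A n, a \<bullet> n + s))"
  define S where "S = insert (0, 1) (N \<times> {0::real})"
  define C where "C = convex_cone hull (f ` S)"
  have f: "linear f"
    unfolding f_def by (rule linearI)
      (auto simp: linear_add[OF adjoint_linear[OF A]] linear_cmul[OF adjoint_linear[OF A]]
        inner_add_right algebra_simps)
  have S: "convex_cone hull S \<subseteq> dual_cone P \<times> {0..}"
    by (rule hull_minimal)
      (auto simp: S_def P dual_cone_def convex_cone_iff inner_add_right zero_prod_def)
  have "(c, \<gamma>) \<in> C"
  proof (rule ccontr)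
    assume "(c, \<gamma>) \<notin> C"
    moreover have "closed C"
      unfolding C_def using N by (intro closed_convex_cone_hull) (auto simp: S_def)
    moreover have "convex C"
      unfolding C_def by (rule convex_convex_cone_hull)
    ultimately obtain w \<beta> where w: "w \<bullet> (c, \<gamma>) < \<beta>" "\<And>x. x \<in> C \<Longrightarrow> \<beta> < w \<bullet> x"
      using separating_hyperplane_closed_point[of C "(c, \<gamma>)"] by blast
    have "\<beta> < 0"
      using w(2)[of 0] convex_cone_hull_contains_0 by (auto simp: C_def)
    \<comment> \<open>A cone cannot take negative values above \<beta>: rescaling x would make the
      functional hit \<beta> exactly, against the strict separation.\<close>
    have nonneg: "0 \<le> w \<bullet> x" if "x \<in> C" for x
    proof (rule ccontr)
      assume "\<not> 0 \<le> w \<bullet> x"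
      then have "0 \<le> \<beta> / (w \<bullet> x)"
        using \<open>\<beta> < 0\<close> by (simp add: divide_nonpos_neg)
      then have "(\<beta> / (w \<bullet> x)) *\<^sub>R x \<in> C"
        using that unfolding C_def by (simp add: convex_cone_hull_mul)
      from w(2)[OF this] show False
        using \<open>\<not> 0 \<le> w \<bullet> x\<close> by simp
    qed
    obtain d s where ds: "w = (d, s)"
      by (cases w)
    have "f y \<in> C" if "y \<in> S" for y
      using that unfolding C_def by (simp add: hull_inc)
    from nonneg[OF this] have *: "0 \<le> d \<bullet> fst (f y) + s * snd (f y)" if "y \<in> S" for y
      using that by (simp add: ds inner_prod_def)
    have s: "0 \<le> s"
      using *[of "(0, 1)"] A by (simp add: S_def f_def linear_0[OF adjoint_linear])
    have d: "0 \<le> A d \<bullet> n + s * (a \<bullet> n)" if "n \<in> N" for n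
      using *[of "(n, 0)"] that A by (simp add: S_def f_def adjoint_works)
    have neg: "d \<bullet> c + s * \<gamma> < 0"
      using w(1) \<open>\<beta> < 0\<close> by (simp add: ds inner_prod_def)
    show False
    \<comment> \<open>If s = 0, then -d is a recession direction of the feasible set along which the
      objective grows without bound. If s > 0, then -d/s is feasible and its objective value exceeds
      \<gamma>.\<close>
    proof (cases "s = 0")
      case True
      have "a - A (z0 - k *\<^sub>R d) \<in> P" if "0 \<le> k" for k
      proof -
        have "0 \<le> k * (A d \<bullet> n)" "0 \<le> (a - A z0) \<bullet> n" if "n \<in> N" for n
          using d[OF that] \<open>0 \<le> k\<close> True feasible that by (simp_all add: P)
        then show ?thesis
          by (force simp: P linear_diff[OF A] linear_cmul[OF A] inner_diff_left)
      qed
      from bound[OF this] have k: "c \<bullet> z0 - k * (c \<bullet> d) \<le> \<gamma>" if "0 \<le> k" for k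
        using that by (simp add: inner_diff_right)
      have cd: "c \<bullet> d < 0"
        using neg True by (simp add: inner_commute)
      \<comment> \<open>The step length at which the objective becomes c . z0 + |\<gamma> - c . z0|
        + 1, which is larger than \<gamma>.\<close>
      define k where "k = (\<bar>\<gamma> - c \<bullet> z0\<bar> + 1) / - (c \<bullet> d)"
      have "0 \<le> k" "k * (c \<bullet> d) = - (\<bar>\<gamma> - c \<bullet> z0\<bar> + 1)"
        using cd by (auto simp: k_def divide_nonneg_neg divide_nonneg_pos zero_le_divide_iff)
      then show False
        using k[of k] by linarith
    next
      case False
      then have "0 < s"
        using s by simp
      have "0 \<le> (a - A (- (d /\<^sub>R s))) \<bullet> n" if "n \<in> N" for n
        using d[OF that] \<open>0 < s\<close>
        by (simp add: linear_neg[OF A] linear_cmul[OF A] inner_add_left field_simps)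
      then have "c \<bullet> (- (d /\<^sub>R s)) \<le> \<gamma>"
        by (intro bound) (simp add: P)
      then show False
        using neg \<open>0 < s\<close> by (simp add: field_simps inner_commute)
    qed
  qed
  then obtain n s where "(c, \<gamma>) = f (n, s)" "(n, s) \<in> convex_cone hull S"
    using convex_cone_hull_linear_image[OF f, of S] unfolding C_def by auto
  then have "adjoint A n = c" "a \<bullet> n \<le> \<gamma>" "n \<in> dual_cone P"
    using S by (auto simp: f_def)
  then show ?thesis
    using adjoint_works[OF A] by (metis inner_commute)
qed

text \<open>
  Only the part \<open>M\<close> of the cone needs Slater's condition: separation first produces a multiplier
  for \<open>M\<close>, and what remains is a linear program, where strong duality holds without it.
\<close>

lemma conic_duality:
  fixes A :: "'z::euclidean_space \<Rightarrow> 'l::euclidean_space"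
  assumes N: "finite N" and A: "linear A"
    and P: "P = {x. \<forall>n\<in>N. 0 \<le> x \<bullet> n}" and M: "convex_cone M"
    and feasible: "a - A z0 \<in> P" "a - A z0 \<in> interior M"
    and bound: "\<And>z. a - A z \<in> P \<inter> M \<Longrightarrow> c \<bullet> z \<le> \<gamma>"
  shows "\<exists>\<mu>\<in>dual_cone (P \<inter> M). (\<forall>z. A z \<bullet> \<mu> = c \<bullet> z) \<and> a \<bullet> \<mu> \<le> \<gamma>"
proof -
  have M0: "0 \<in> M" and Madd: "\<And>x y. x \<in> M \<Longrightarrow> y \<in> M \<Longrightarrow> x + y \<in> M"
    and Mmul: "\<And>x k. x \<in> M \<Longrightarrow> 0 \<le> k \<Longrightarrow> k *\<^sub>R x \<in> M"
    using M by (auto simp: convex_cone_iff)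
  have "convex P"
    by (auto simp: P convex_def inner_add_left)
  \<comment> \<open>Only the constraint in \<open>M\<close> is perturbed; the one in
    \<open>P\<close> is kept exact. A point (0, \<rho>) of \<open>D\<close> with \<rho> > \<gamma>
    would be a feasible z with objective above \<gamma>, so \<open>D\<close> misses the ray used
    below.\<close>
  define D where "D = {(a - A z - y, c \<bullet> z - r) | z y r. a - A z \<in> P \<and> y \<in> M \<and> 0 \<le> r}"
  have D_I: "(a - A z - y, c \<bullet> z - r) \<in> D" if "a - A z \<in> P" "y \<in> M" "0 \<le> r" for z y r
    using that by (auto simp: D_def)
  have "convex D"
  proof (rule convexI)
    fix x x' and u v :: real
    assume "x \<in> D" "x' \<in> D" and uv: "0 \<le> u" "0 \<le> v" "u + v = 1"
    then obtain z y r z' y' r' where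
      *: "x = (a - A z - y, c \<bullet> z - r)" "a - A z \<in> P" "y \<in> M" "0 \<le> r"
        "x' = (a - A z' - y', c \<bullet> z' - r')" "a - A z' \<in> P" "y' \<in> M" "0 \<le> r'"
      unfolding D_def by auto
    define z'' where "z'' = u *\<^sub>R z + v *\<^sub>R z'"
    have a: "a = u *\<^sub>R a + v *\<^sub>R a"
      by (metis uv(3) scaleR_left.add scaleR_one)
    have Az: "a - A z'' = u *\<^sub>R (a - A z) + v *\<^sub>R (a - A z')"
      unfolding z''_def
      by (subst a) (simp add: linear_add[OF A] linear_cmul[OF A] algebra_simps)
    have "a - A z'' \<in> P"
      unfolding Az using \<open>convex P\<close> * uv by (auto simp: convex_def)
    then have "(a - A z'' - (u *\<^sub>R y + v *\<^sub>R y'), c \<bullet> z'' - (u * r + v * r')) \<in> D"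
      using * uv by (intro D_I Madd Mmul) auto
    also have "(a - A z'' - (u *\<^sub>R y + v *\<^sub>R y'), c \<bullet> z'' - (u * r + v * r')) = u *\<^sub>R x + v *\<^sub>R x'"
      unfolding Az by (simp add: * z''_def inner_add_right algebra_simps)
    finally show "u *\<^sub>R x + v *\<^sub>R x' \<in> D" .
  qed
  moreover have "convex ({0::'l} \<times> {\<gamma><..})"
    by (intro convex_Times) auto
  moreover have "D \<noteq> {}"
    using D_I[OF feasible(1) M0, of 0] by auto
  moreover have "{0::'l} \<times> {\<gamma><..} \<noteq> {}"
    by (auto simp: gt_ex)
  moreover have "D \<inter> {0} \<times> {\<gamma><..} = {}"
    using bound unfolding D_def by fastforce
  ultimately obtain w \<beta> where w: "w \<noteq> 0" "\<And>x. x \<in> D \<Longrightarrow> w \<bullet> x \<le> \<beta>"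
      "\<And>x. x \<in> {0} \<times> {\<gamma><..} \<Longrightarrow> \<beta> \<le> w \<bullet> x"
    using separating_hyperplane_sets[of D "{0} \<times> {\<gamma><..}"] by metis
  obtain \<nu> \<tau> where "w = (\<nu>, \<tau>)"
    by (cases w)
  note w = w[unfolded this]
  have \<nu>\<tau>: "\<nu> \<noteq> 0 \<or> \<tau> \<noteq> 0"
    using w(1) by (simp add: zero_prod_def)
  have up: "\<nu> \<bullet> (a - A z - y) + \<tau> * (c \<bullet> z - r) \<le> \<beta>"
    if "a - A z \<in> P" "y \<in> M" "0 \<le> r" for z y r
    using w(2)[OF D_I[OF that]] by simp
  have lo: "\<beta> \<le> \<tau> * \<rho>" if "\<gamma> < \<rho>" for \<rho>
    using w(3)[of "(0, \<rho>)"] that by simp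
  \<comment> \<open>For negative \<tau> the lower bound fails at large \<rho>; the chosen \<rho>
    makes \<tau> \<rho> at most \<beta> - 1.\<close>
  have \<tau>: "0 \<le> \<tau>"
  proof (rule ccontr)
    assume "\<not> 0 \<le> \<tau>"
    then show False
      using lo[of "max (\<gamma> + 1) ((\<beta> - 1) / \<tau>)"] max.cobounded2[of "(\<beta> - 1) / \<tau>" "\<gamma> + 1"]
      by (smt (verit) max.cobounded1 mult_left_mono_neg nonzero_mult_div_cancel_left times_divide_eq_right)
  qed
  have \<beta>: "\<beta> \<le> \<tau> * \<gamma>"
  proof (rule field_le_epsilon)
    fix e :: real assume "0 < e"
    \<comment> \<open>Let \<rho> decrease to \<gamma>. The denominator is \<tau> + 1 because \<tau>
      may still be zero at this point.\<close>
    have "\<beta> \<le> \<tau> * (\<gamma> + e / (\<tau> + 1))"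
      using \<tau> \<open>0 < e\<close> by (intro lo) simp
    also have "\<dots> \<le> \<tau> * \<gamma> + e"
      using \<tau> \<open>0 < e\<close> by (simp add: field_simps)
    finally show "\<beta> \<le> \<tau> * \<gamma> + e" .
  qed
  \<comment> \<open>Since y may be replaced by any nonnegative multiple in \<open>up\<close>, a
    negative value of \<nu> . y would make its left-hand side unbounded.\<close>
  have \<nu>M: "0 \<le> \<nu> \<bullet> y" if "y \<in> M" for y
  proof (rule ccontr)
    assume neg: "\<not> 0 \<le> \<nu> \<bullet> y"
    define h where "h = \<nu> \<bullet> (a - A z0) + \<tau> * (c \<bullet> z0)"
    have *: "h - k * (\<nu> \<bullet> y) \<le> \<beta>" if "0 \<le> k" for k
      using up[OF feasible(1) Mmul[OF \<open>y \<in> M\<close> that], of 0]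
      by (simp add: h_def inner_diff_right)
    define k where "k = (\<bar>\<beta> - h\<bar> + 1) / - (\<nu> \<bullet> y)"
    have "0 \<le> k" "k * (\<nu> \<bullet> y) = - (\<bar>\<beta> - h\<bar> + 1)"
      using neg by (auto simp: k_def divide_nonneg_neg)
    then show False
      using *[of k] by linarith
  qed
  \<comment> \<open>This is where Slater's condition enters. If \<tau> = 0, then \<nu> is nonzero
    and nonpositive at the point a - A z0; a step from there along -\<nu> stays in \<open>M\<close>
    but makes \<nu> negative.\<close>
  have "\<tau> \<noteq> 0"
  proof
    assume "\<tau> = 0"
    then have "\<nu> \<noteq> 0"
      using \<nu>\<tau> by simp
    obtain e where e: "0 < e" "cball (a - A z0) e \<subseteq> M"
      using feasible(2) by (auto simp: mem_interior_cball)
    define y where "y = a - A z0 - (e / norm \<nu>) *\<^sub>R \<nu>"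
    have "y \<in> M"
      using e \<open>\<nu> \<noteq> 0\<close> by (intro subsetD[OF e(2)]) (simp add: y_def dist_norm)
    moreover have "\<nu> \<bullet> (a - A z0) \<le> 0"
      using up[OF feasible(1) M0, of 0] \<beta> \<open>\<tau> = 0\<close> by simp
    moreover have "0 < (e / norm \<nu>) * (\<nu> \<bullet> \<nu>)"
      using e \<open>\<nu> \<noteq> 0\<close> by simp
    ultimately show False
      using \<nu>M[of y] by (simp add: y_def inner_diff_right)
  qed
  then have \<tau>: "0 < \<tau>"
    using \<tau> by simp
  define \<kappa> where "\<kappa> = \<nu> /\<^sub>R \<tau>"
  have \<kappa>: "\<kappa> \<in> dual_cone M"
    using \<nu>M \<tau> by (simp add: \<kappa>_def dual_cone_def inner_commute)
  \<comment> \<open>Moving the \<kappa>-term into the objective leaves a problem constrained by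
    \<open>P\<close> alone. Its multiplier \<theta>, added to \<kappa>, certifies the original
    bound.\<close>
  have "(c - adjoint A \<kappa>) \<bullet> z \<le> \<gamma> - a \<bullet> \<kappa>" if "a - A z \<in> P" for z
  proof -
    have "\<nu> \<bullet> (a - A z) + \<tau> * (c \<bullet> z) \<le> \<tau> * \<gamma>"
      using up[OF that M0, of 0] \<beta> by simp
    moreover have "\<nu> = \<tau> *\<^sub>R \<kappa>"
      using \<tau> by (simp add: \<kappa>_def)
    ultimately have "\<tau> * (\<kappa> \<bullet> (a - A z) + c \<bullet> z) \<le> \<tau> * \<gamma>"
      by (simp add: algebra_simps)
    then have "\<kappa> \<bullet> (a - A z) + c \<bullet> z \<le> \<gamma>"
      using \<tau> by simp
    then show ?thesis
      using adjoint_works[OF A, of z \<kappa>]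
      by (simp add: inner_diff_left inner_diff_right inner_commute)
  qed
  then obtain \<theta> where \<theta>: "\<theta> \<in> dual_cone P"
      "\<And>z. A z \<bullet> \<theta> = (c - adjoint A \<kappa>) \<bullet> z" "a \<bullet> \<theta> \<le> \<gamma> - a \<bullet> \<kappa>"
    using polyhedral_cone_duality[OF N A P feasible(1)] by blast
  show ?thesis
  proof (intro bexI[of _ "\<theta> + \<kappa>"] conjI allI)
    show "\<theta> + \<kappa> \<in> dual_cone (P \<inter> M)"
      using \<theta>(1) \<kappa> by (auto simp: dual_cone_def inner_add_right)
    show "A z \<bullet> (\<theta> + \<kappa>) = c \<bullet> z" for z
      using adjoint_works[OF A, of z \<kappa>]
      by (simp add: inner_add_right \<theta>(2) inner_diff_left inner_commute[of "adjoint A \<kappa>" z])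
    show "a \<bullet> (\<theta> + \<kappa>) \<le> \<gamma>"
      using \<theta>(3) by (simp add: inner_add_right)
  qed
qed

section \<open>Cones in coordinates\<close>

lemma
  fixes e :: "nat \<Rightarrow> 'k::euclidean_space"
  assumes e: "basis_enum e"
  shows inner_basis_enum: "x \<bullet> y = (\<Sum>i<DIM('k). (x \<bullet> e i) * (y \<bullet> e i))"
    and inj_coords: "inj (coords e)"
    and range_coords: "range (coords e) = topspace (Euclidean_space DIM('k))"
proof -
  have bij: "bij_betw e {..<DIM('k)} Basis"
    using e by (simp add: basis_enum_def)
  show "x \<bullet> y = (\<Sum>i<DIM('k). (x \<bullet> e i) * (y \<bullet> e i))"
    unfolding euclidean_inner[of x y] by (rule sum.reindex_bij_betw[OF bij, symmetric])
  show "inj (coords e)"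
  proof (rule injI)
    fix x y assume eq: "coords e x = coords e y"
    have "x \<bullet> e i = y \<bullet> e i" if "i < DIM('k)" for i
      using fun_cong[OF eq, of i] that by (simp add: coords_def)
    moreover have "b \<in> e ` {..<DIM('k)}" if "b \<in> Basis" for b
      using that bij_betw_imp_surj_on[OF bij] by simp
    ultimately show "x = y"
      by (metis euclidean_eqI imageE lessThan_iff)
  qed
  show "range (coords e) = topspace (Euclidean_space DIM('k))"
  proof
    show "range (coords e) \<subseteq> topspace (Euclidean_space DIM('k))"
      by (auto simp: coords_def topspace_Euclidean_space)
    show "topspace (Euclidean_space DIM('k)) \<subseteq> range (coords e)"
    proof
      fix c :: "nat \<Rightarrow> real" assume c: "c \<in> topspace (Euclidean_space DIM('k))"
      have orth: "e i \<bullet> e j = (if i = j then 1 else 0)" if "i < DIM('k)" "j < DIM('k)" for i j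
        using that bij_betw_apply[OF bij] bij_betw_imp_inj_on[OF bij]
        by (auto simp: inner_Basis inj_on_def)
      have "coords e (\<Sum>i<DIM('k). c i *\<^sub>R e i) = c"
        using c by (auto simp: coords_def fun_eq_iff topspace_Euclidean_space inner_sum_left orth
            if_distrib[of "\<lambda>t. _ * t"] cong: if_cong)
      then show "c \<in> range (coords e)"
        by (metis rangeI)
    qed
  qed
qed

text \<open>Coordinates preserve inner products and fill all of R^n, so they commute with taking
  duals. This transfers the closure of the family under \<open>coord_dual\<close> to cones in
  abstract Euclidean spaces.\<close>

lemma coords_image_dual_cone:
  fixes e :: "nat \<Rightarrow> 'k::euclidean_space"
  assumes e: "basis_enum e"
  shows "coords e ` dual_cone K = coord_dual DIM('k) (coords e ` K)"
proof -
  have "(\<Sum>i<DIM('k). coords e x i * coords e y i) = x \<bullet> y" for x y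
    by (simp add: inner_basis_enum[OF e, of x y] coords_def)
  then show ?thesis
    unfolding coord_dual_def dual_cone_def by (auto simp: range_coords[OF e, symmetric])
qed

lemma in_family_dual_cone:
  fixes K :: "'a::euclidean_space set"
  assumes "cone_family \<K>" "in_family \<K> K"
  shows "in_family \<K> (dual_cone K)"
proof -
  obtain e where e: "basis_enum e" "coords e ` K \<in> \<K> DIM('a)"
    using assms(2) by (auto simp: in_family_def)
  then have "coords e ` dual_cone K \<in> \<K> DIM('a)"
    using assms(1) by (simp add: cone_family_def coords_image_dual_cone)
  then show ?thesis
    using e(1) by (auto simp: in_family_def)
qed

text \<open>The second component of \<open>coords e x\<close> as a point of a product in R^(m + q),
  with its indices shifted back to start at 0. It is continuous in x, so open sets of R^q pull back
  to open sets.\<close>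

definition tail_coords :: "(nat \<Rightarrow> 'k::euclidean_space) \<Rightarrow> nat \<Rightarrow> nat \<Rightarrow> 'k \<Rightarrow> nat \<Rightarrow> real" where
  "tail_coords e m q x = (\<lambda>i. if i < q then x \<bullet> e (m + i) else 0)"

text \<open>\<open>M\<close> is an arbitrary subset of R^q here because the criterion is applied
  both to a cone and to its interior.\<close>

lemma coords_mem_direct_prod_iff:
  fixes x :: "'k::euclidean_space"
  assumes dim: "m + q = DIM('k)" and M: "M \<subseteq> topspace (Euclidean_space q)"
  shows "coords e x \<in> direct_prod m (orthant m) M \<longleftrightarrow>
    (\<forall>i<m. 0 \<le> x \<bullet> e i) \<and> tail_coords e m q x \<in> M"
proof
  assume "coords e x \<in> direct_prod m (orthant m) M"
  then obtain u v where uv: "coords e x = (\<lambda>i. if i < m then u i else v (i - m))"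
      "u \<in> orthant m" "v \<in> M"
    unfolding direct_prod_def by blast
  have "x \<bullet> e i = u i" if "i < m" for i
    using fun_cong[OF uv(1), of i] that dim by (simp add: coords_def)
  moreover have "tail_coords e m q x = v"
  proof
    fix i
    show "tail_coords e m q x i = v i"
      using fun_cong[OF uv(1), of "m + i"] dim
      by (auto simp: coords_def tail_coords_def)
  qed
  ultimately show "(\<forall>i<m. 0 \<le> x \<bullet> e i) \<and> tail_coords e m q x \<in> M"
    using uv(2,3) by (auto simp: orthant_def)
next
  assume *: "(\<forall>i<m. 0 \<le> x \<bullet> e i) \<and> tail_coords e m q x \<in> M"
  show "coords e x \<in> direct_prod m (orthant m) M"
    unfolding direct_prod_def
  proof (intro CollectI exI conjI)
    show "coords e x = (\<lambda>i. if i < m then (if i < m then x \<bullet> e i else 0) else tail_coords e m q x (i - m))"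
      using dim by (auto simp: coords_def tail_coords_def fun_eq_iff)
    show "(\<lambda>i. if i < m then x \<bullet> e i else 0) \<in> orthant m"
      using * by (auto simp: orthant_def topspace_Euclidean_space)
  qed (use * in blast)
qed

text \<open>This brings the coordinate definition into the form that \<open>conic_duality\<close>
  takes. The orthant factor becomes finitely many half-spaces with basis vectors as normals, and the
  other factor becomes a cylinder over \<open>M\<close>. The cylinder contains lines when m > 0, so
  it is described only as a convex cone.\<close>

lemma ess_strictly_feasible_polyhedral_Int:
  fixes L :: "'l::euclidean_space set"
  assumes "ess_strictly_feasible L A b"
  obtains N M z where "finite N" "convex_cone M" "L = {x. \<forall>n\<in>N. 0 \<le> x \<bullet> n} \<inter> M"
    "b - A z \<in> {x. \<forall>n\<in>N. 0 \<le> x \<bullet> n}" "b - A z \<in> interior M"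
proof -
  obtain e m q M z where e: "basis_enum e" and dim: "m + q = DIM('l)"
    and M: "regular_cone q M" and L: "coords e ` L = direct_prod m (orthant m) M"
    and z: "coords e (b - A z) \<in> direct_prod m (orthant m) (Euclidean_space q interior_of M)"
    using assms unfolding ess_strictly_feasible_def by auto
  define N where "N = e ` {..<m}"
  define M' where "M' = tail_coords e m q -` M"
  define I where "I = tail_coords e m q -` (Euclidean_space q interior_of M)"
  have closed: "M \<subseteq> topspace (Euclidean_space q)"
    using M closedin_subset by (auto simp: regular_cone_def)
  have comb: "(\<lambda>i. r * x i + s * y i) \<in> M" if "x \<in> M" "y \<in> M" "0 \<le> r" "0 \<le> s" for x y r s
    using M that by (simp add: regular_cone_def)
  have "open I"
  proof -
    have "continuous_map euclidean (Euclidean_space q) (tail_coords e m q)"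
      unfolding Euclidean_space_def continuous_map_in_subtopology continuous_map_componentwise_UNIV
      by (auto simp: tail_coords_def intro!: continuous_intros)
    then have "openin euclidean {x \<in> topspace euclidean. tail_coords e m q x \<in> Euclidean_space q interior_of M}"
      using openin_continuous_map_preimage openin_interior_of by blast
    then show ?thesis
      by (simp add: I_def vimage_def)
  qed
  moreover have "I \<subseteq> M'"
    using interior_of_subset unfolding I_def M'_def by fast
  \<comment> \<open>The preimage of the interior of \<open>M\<close> is an open subset of the
    cylinder, so strict feasibility in R^q gives an interior point of the cylinder.\<close>
  ultimately have IM: "I \<subseteq> interior M'"
    by (simp add: interior_maximal)
  show thesis
  proof
    show "finite N"
      by (simp add: N_def)
    show "L = {x. \<forall>n\<in>N. 0 \<le> x \<bullet> n} \<inter> M'"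
    proof -
      have "x \<in> L \<longleftrightarrow> coords e x \<in> direct_prod m (orthant m) M" for x
        using inj_image_mem_iff[OF inj_coords[OF e]] L by metis
      then show ?thesis
        by (auto simp: coords_mem_direct_prod_iff[OF dim closed] N_def M'_def)
    qed
    show "b - A z \<in> {x. \<forall>n\<in>N. 0 \<le> x \<bullet> n}" and z': "b - A z \<in> interior M'"
      using z IM interior_of_subset_topspace[of "Euclidean_space q" M]
      by (auto simp: coords_mem_direct_prod_iff[OF dim] N_def I_def)
    show "convex_cone M'"
    proof -
      have add: "x + y \<in> M'" if "x \<in> M'" "y \<in> M'" for x y
      proof -
        have "tail_coords e m q (x + y) = (\<lambda>i. 1 * tail_coords e m q x i + 1 * tail_coords e m q y i)"
          by (auto simp: tail_coords_def inner_add_left)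
        then show ?thesis
          using comb[of "tail_coords e m q x" "tail_coords e m q y" 1 1] that by (simp add: M'_def)
      qed
      have mul: "c *\<^sub>R x \<in> M'" if "x \<in> M'" "0 \<le> c" for c x
      proof -
        have "tail_coords e m q (c *\<^sub>R x) = (\<lambda>i. c * tail_coords e m q x i + 0 * tail_coords e m q x i)"
          by (auto simp: tail_coords_def)
        then show ?thesis
          using comb[of "tail_coords e m q x" "tail_coords e m q x" c 0] that by (simp add: M'_def)
      qed
      have "b - A z \<in> M'"
        using z' interior_subset by blast
      then have "0 \<in> M'"
        using mul[of _ 0] by fastforce
      then show ?thesis
        using add mul by (simp add: convex_cone_iff)
    qed
  qed
qed

section \<open>The dual description of the supremum bound\<close>

text \<open>Weak duality: pair the slack b - (A x + B v) in \<open>L\<close> with \<mu> in the dual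
  cone. The equations of the system cancel the v-term and turn the x-term into g . x.\<close>

lemma dual_system_weak:
  assumes A: "linear A" and B: "linear B"
    and dual: "dual_system A B L b \<epsilon> t g \<mu>" and feasible: "A x + B v \<preceq>\<^bsub>L\<^esub> b"
  shows "t - g \<bullet> x \<le> \<epsilon>"
proof -
  have \<mu>: "adjoint A \<mu> = - g" "adjoint B \<mu> = 0" "t + b \<bullet> \<mu> \<le> \<epsilon>" "\<mu> \<in> dual_cone L"
    using dual by (auto simp: dual_system_def cone_le_def eq_neg_iff_add_eq_0)
  have "0 \<le> (b - (A x + B v)) \<bullet> \<mu>"
    using \<mu>(4) feasible by (simp add: dual_cone_def cone_le_def)
  moreover have "A x \<bullet> \<mu> = - (g \<bullet> x)" "B v \<bullet> \<mu> = 0"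
    using adjoint_works[OF A, of x \<mu>] adjoint_works[OF B, of v \<mu>] \<mu>(1,2)
    by (simp_all add: inner_commute)
  ultimately show ?thesis
    using \<mu>(3) by (simp add: inner_diff_left inner_add_left)
qed

lemma dual_system_strong:
  assumes A: "linear A" and B: "linear B"
    and strict: "ess_strictly_feasible L (\<lambda>(x, v). A x + B v) b"
    and bound: "\<And>x v. A x + B v \<preceq>\<^bsub>L\<^esub> b \<Longrightarrow> t - g \<bullet> x \<le> \<epsilon>"
  shows "\<exists>\<mu>. dual_system A B L b \<epsilon> t g \<mu>"
proof -
  let ?A = "\<lambda>(x, v). A x + B v"
  obtain N M z where *: "finite N" "convex_cone M" and L: "L = {x. \<forall>n\<in>N. 0 \<le> x \<bullet> n} \<inter> M"
    and z: "b - ?A z \<in> {x. \<forall>n\<in>N. 0 \<le> x \<bullet> n}" "b - ?A z \<in> interior M"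
    using strict by (rule ess_strictly_feasible_polyhedral_Int)
  have lin: "linear ?A"
    by (rule linearI)
      (auto simp: linear_add[OF A] linear_add[OF B] linear_cmul[OF A] linear_cmul[OF B] algebra_simps)
  \<comment> \<open>The bound is read as a conic program in the joint variable (x, v): maximize -g .
    x, with value at most \<epsilon> - t. The zero in the objective is what forces adjoint B \<mu> =
    0.\<close>
  have "(- g, 0) \<bullet> z \<le> \<epsilon> - t" if "b - ?A z \<in> {x. \<forall>n\<in>N. 0 \<le> x \<bullet> n} \<inter> M" for z
    using bound[of "fst z" "snd z"] that
    unfolding cone_le_def L[symmetric] by (simp add: inner_prod_def case_prod_unfold)
  then obtain \<mu> where \<mu>: "\<mu> \<in> dual_cone L" "\<And>z. ?A z \<bullet> \<mu> = (- g, 0) \<bullet> z" "b \<bullet> \<mu> \<le> \<epsilon> - t"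
    using conic_duality[OF *(1) lin refl *(2) z] unfolding L by blast
  have "A x \<bullet> \<mu> = - (g \<bullet> x)" "B v \<bullet> \<mu> = 0" for x v
    using \<mu>(2)[of "(x, 0)"] \<mu>(2)[of "(0, v)"] by (simp_all add: linear_0[OF A] linear_0[OF B])
  then have "\<forall>x. x \<bullet> (adjoint A \<mu> + g) = 0" "\<forall>v. v \<bullet> adjoint B \<mu> = 0"
    by (simp_all add: inner_add_right adjoint_works[OF A] adjoint_works[OF B] inner_commute)
  then have "adjoint A \<mu> + g = 0" "adjoint B \<mu> = 0"
    using inner_eq_zero_iff by blast+
  then show ?thesis
    using \<mu>(1,3) by (auto simp: dual_system_def cone_le_def algebra_simps)
qed

section \<open>The variational inequality\<close>

lemma strong_variational_inequality_solution:
  fixes F :: "'e::euclidean_space \<Rightarrow> 'e"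
  assumes S: "S \<noteq> {}" "convex S" "compact S" and F: "continuous_on S F"
  obtains x where "x \<in> S" "\<And>y. y \<in> S \<Longrightarrow> F x \<bullet> (x - y) \<le> 0"
proof -
  let ?f = "\<lambda>x. closest_point S (x - F x)"
  have "closed S"
    using S by (simp add: compact_imp_closed)
  have "continuous_on S ?f"
    by (rule continuous_on_compose2[OF continuous_on_closest_point[OF S(2) \<open>closed S\<close> S(1), of UNIV]])
      (auto intro!: continuous_intros F)
  moreover have "?f \<in> S \<rightarrow> S"
    using closest_point_in_set[OF \<open>closed S\<close> S(1)] by auto
  ultimately obtain x where x: "x \<in> S" "?f x = x"
    using brouwer[OF S(3,2,1)] by blast
  show thesis
  proof
    \<comment> \<open>The obtuse-angle property of the projection of x - F x, at the fixed point x,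
      reads -F x . (y - x) <= 0.\<close>
    show "F x \<bullet> (x - y) \<le> 0" if "y \<in> S" for y
      using closest_point_dot[OF S(2) \<open>closed S\<close> that, of "x - F x"] x(2)
      by (simp add: inner_diff_right)
  qed (fact x(1))
qed

theorem proposition4p1:
  fixes \<K> :: "nat \<Rightarrow> (nat \<Rightarrow> real) set set"
    and \<X> :: "'e::euclidean_space set"
    and A :: "'e \<Rightarrow> 'l::euclidean_space" and B :: "'v::euclidean_space \<Rightarrow> 'l"
    and L :: "'l set" and b :: 'l
    and F :: "'e \<Rightarrow> 'e"
    and X G :: "'e \<Rightarrow> 'k::euclidean_space" and T :: 'k and U :: "'u::euclidean_space \<Rightarrow> 'k"
    and K :: "'k set" and a :: 'k
  assumes "cone_family \<K>"
    and "\<X> \<noteq> {}" and "convex \<X>" and "compact \<X>"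
    and "set_representation \<K> \<X> A B L b"
    and "ess_strictly_feasible L (\<lambda>(x, v). A x + B v) b"
    and "continuous_on \<X> F" and "monotone_field F \<X>"
  shows "in_family \<K> (dual_cone L) \<and>
    (\<forall>\<epsilon>\<ge>0. dual_set \<X> \<epsilon> = {(t, g). \<exists>\<mu>. dual_system A B L b \<epsilon> t g \<mu>}) \<and>
    (almost_field_representation \<K> F \<X> X G T U K a \<longrightarrow>
      (\<forall>\<epsilon>>0.
        (\<exists>x g t u \<mu>. X x + G g + t *\<^sub>R T + U u \<preceq>\<^bsub>K\<^esub> a \<and> dual_system A B L b \<epsilon> t g \<mu>) \<and>
        (\<forall>x g t u \<mu>. X x + G g + t *\<^sub>R T + U u \<preceq>\<^bsub>K\<^esub> a \<and> dual_system A B L b \<epsilon> t g \<mu> \<longrightarrow>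
          x \<in> \<X> \<and> (SUP y\<in>\<X>. F y \<bullet> (x - y)) \<le> \<epsilon>))) \<and>
    (field_representation \<K> F \<X> X G T U K a \<longrightarrow>
      (\<forall>\<epsilon>\<ge>0.
        (\<exists>x g t u \<mu>. X x + G g + t *\<^sub>R T + U u \<preceq>\<^bsub>K\<^esub> a \<and> dual_system A B L b \<epsilon> t g \<mu>) \<and>
        (\<forall>x g t u \<mu>. X x + G g + t *\<^sub>R T + U u \<preceq>\<^bsub>K\<^esub> a \<and> dual_system A B L b \<epsilon> t g \<mu> \<longrightarrow>
          x \<in> \<X> \<and> (SUP y\<in>\<X>. F y \<bullet> (x - y)) \<le> \<epsilon>)))"
proof -
  have A: "linear A" and B: "linear B" and L: "in_family \<K> L"
    and \<X>: "\<X> = {x. \<exists>v. A x + B v \<preceq>\<^bsub>L\<^esub> b}"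
    using \<open>set_representation \<K> \<X> A B L b\<close> by (auto simp: set_representation_def)
  have dual_iff: "(\<exists>\<mu>. dual_system A B L b \<epsilon> t g \<mu>) \<longleftrightarrow> (\<forall>y\<in>\<X>. t - g \<bullet> y \<le> \<epsilon>)" for \<epsilon> t g
    using dual_system_weak[OF A B]
      dual_system_strong[OF A B \<open>ess_strictly_feasible L (\<lambda>(x, v). A x + B v) b\<close>]
    unfolding \<X> by blast
  have "dual_set \<X> \<epsilon> = {(t, g). \<exists>\<mu>. dual_system A B L b \<epsilon> t g \<mu>}" for \<epsilon>
  proof -
    \<comment> \<open>Boundedness makes the real supremum a genuine one, so that bounding it is the
      same as bounding every value.\<close>
    have "bdd_above ((\<lambda>y. t - g \<bullet> y) ` \<X>)" for t g
      using \<open>compact \<X>\<close>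
      by (intro bounded_imp_bdd_above compact_imp_bounded compact_continuous_image continuous_intros)
    then have "(SUP y\<in>\<X>. t - g \<bullet> y) \<le> \<epsilon> \<longleftrightarrow> (\<forall>y\<in>\<X>. t - g \<bullet> y \<le> \<epsilon>)" for t g
      by (intro cSUP_le_iff \<open>\<X> \<noteq> {}\<close>)
    then show ?thesis
      by (simp add: dual_set_def dual_iff)
  qed
  moreover have "x \<in> \<X> \<and> (SUP y\<in>\<X>. F y \<bullet> (x - y)) \<le> \<epsilon>"
    if proj: "constraint_proj X G T U K a \<subseteq> field_set F \<X>"
      and feas: "X x + G g + t *\<^sub>R T + U u \<preceq>\<^bsub>K\<^esub> a" and dual: "dual_system A B L b \<epsilon> t g \<mu>"
    for x g t u \<mu> \<epsilon>
  proof -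
    have "(t, g, x) \<in> field_set F \<X>"
      using feas by (intro subsetD[OF proj]) (auto simp: constraint_proj_def)
    then have x: "x \<in> \<X>" "\<And>y. y \<in> \<X> \<Longrightarrow> F y \<bullet> (x - y) \<le> t - g \<bullet> y"
      by (auto simp: field_set_def)
    have "t - g \<bullet> y \<le> \<epsilon>" if "y \<in> \<X>" for y
      using that dual dual_iff by blast
    then have "F y \<bullet> (x - y) \<le> \<epsilon>" if "y \<in> \<X>" for y
      using x(2)[OF that] that by fastforce
    then show ?thesis
      using x(1) by (intro conjI cSUP_least \<open>\<X> \<noteq> {}\<close>)
  qed
  moreover obtain x where x: "x \<in> \<X>" "\<And>y. y \<in> \<X> \<Longrightarrow> F x \<bullet> (x - y) \<le> 0"
    using strong_variational_inequality_solution[of \<X> F] assms by blast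
  have "\<exists>x g t u \<mu>. X x + G g + t *\<^sub>R T + U u \<preceq>\<^bsub>K\<^esub> a \<and> dual_system A B L b \<epsilon> t g \<mu>"
    if "(F x \<bullet> x + \<epsilon>, F x, x) \<in> constraint_proj X G T U K a" for \<epsilon>
  proof -
    \<comment> \<open>With this t, the quantity t - F x . y equals F x . (x - y) + \<epsilon>, which
      is at most \<epsilon> because x is a strong solution.\<close>
    have "\<exists>\<mu>. dual_system A B L b \<epsilon> (F x \<bullet> x + \<epsilon>) (F x) \<mu>"
      using x(2) by (simp add: dual_iff inner_diff_right)
    then show ?thesis
      using that by (auto simp: constraint_proj_def)
  qed
  \<comment> \<open>Positive \<epsilon> places t strictly above F x . x, as an almost representation
    demands.\<close>
  moreover have "(F x \<bullet> x + \<epsilon>, F x, x) \<in> constraint_proj X G T U K a"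
    if "almost_field_representation \<K> F \<X> X G T U K a" "0 < \<epsilon>" for \<epsilon>
    using that x(1) by (auto simp: almost_field_representation_def)
  \<comment> \<open>A representation contains the point with t = F x . x itself, and t-monotonicity
    raises it by any \<epsilon> >= 0.\<close>
  moreover have "(F x \<bullet> x + \<epsilon>, F x, x) \<in> constraint_proj X G T U K a"
    if "field_representation \<K> F \<X> X G T U K a" "0 \<le> \<epsilon>" for \<epsilon>
  proof -
    have "(F x \<bullet> x, F x, x) \<in> constraint_proj X G T U K a"
      using that(1) x(1) by (auto simp: field_representation_def)
    moreover have "t_monotone (constraint_proj X G T U K a)"
      using that(1) by (simp add: field_representation_def)
    ultimately show ?thesis
      using that(2) unfolding t_monotone_def by (metis le_add_same_cancel1)
  qed
  ultimately show ?thesis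
    using in_family_dual_cone[OF \<open>cone_family \<K>\<close> L]
    unfolding almost_field_representation_def field_representation_def by auto
qed

end
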